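(* Let $X$ be a compact Hausdorff space, let $\mathcal{A}\subset C(X)$ be a uniform algebra, and let $\mathcal{H}$ be a complex Hilbert space. Let $\theta:\mathcal{A}\to B(\mathcal{H})$ be a bounded unital homomorphism, and let $\alpha:\mathcal{A}\to\mathcal{A}$ be a bounded unital antilinear map. Define $$\Phi(h)=\frac12\bigl(\theta(h)+\theta(\alpha(h))^*\bigr),\qquad h\in\mathcal{A}.$$ If $\Phi$ is contractive, i.e. $\|\Phi(h)\|\le \|h\|_X$ for all $h\in\mathcal{A}$, then $\|\theta\|\le 2$, i.e. $\|\theta(h)\|\le 2\|h\|_X$ for all $h\in\mathcal{A}$.
   Context: A uniform algebra on a compact Hausdorff space $X$ is a unital norm-closed (complex) subalgebra $\mathcal{A}$ of $C(X)$, the algebra of continuous complex-valued functions on $X$, equipped with the uniform norm $\|h\|_X=\sup_{x\in X}|h(x)|$; it contains the constant function $1$. (Separation of points is not required.) $B(\mathcal{H})$ denotes the bounded linear operators on $\mathcal{H}$ with operator norm. Homomorphisms are complex-linear, multiplicative and unital ($\theta(1)=I$). A map $\alpha$ is antilinear if it is additive and $\alpha(\lambda h)=\overline{\lambda}\,\alpha(h)$ for $\lambda\in\mathbb{C}$; it is unital if $\alpha(1)=1$; it is bounded if there is $C<\infty$ with $\|\alpha(h)\|_X\le C\|h\|_X$ for all $h$. The map $\alpha$ is not assumed multiplicative or contractive. *)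

theory Defs
  imports "HOL-Analysis.Analysis"
begin

section \<open>Complex normed spaces and complex Hilbert spaces\<close>

class complex_normed_vector = real_normed_vector +
  fixes scaleC :: "complex \<Rightarrow> 'a \<Rightarrow> 'a"  (infixr \<open>*\<^sub>C\<close> 75)
  assumes scaleC_add_right: "a *\<^sub>C (x + y) = a *\<^sub>C x + a *\<^sub>C y"
    and scaleC_add_left: "(a + b) *\<^sub>C x = a *\<^sub>C x + b *\<^sub>C x"
    and scaleC_scaleC: "a *\<^sub>C b *\<^sub>C x = (a * b) *\<^sub>C x"
    and scaleC_of_real: "complex_of_real r *\<^sub>C x = r *\<^sub>R x"
    and norm_scaleC: "norm (a *\<^sub>C x) = cmod a * norm x"

text \<open>
  The inner product is linear in its first and conjugate-linear in its second argument.
  Positive definiteness is contained in the last axiom.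
\<close>

class complex_hilbert_space = complex_normed_vector + complete_space +
  fixes cinner :: "'a \<Rightarrow> 'a \<Rightarrow> complex"
  assumes cinner_commute: "cinner x y = cnj (cinner y x)"
    and cinner_add_left: "cinner (x + y) z = cinner x z + cinner y z"
    and cinner_scaleC_left: "cinner (a *\<^sub>C x) y = a * cinner x y"
    and cinner_self: "cinner x x = complex_of_real ((norm x)\<^sup>2)"

instantiation complex :: complex_hilbert_space
begin

definition "scaleC_complex (a :: complex) (x :: complex) = a * x"
definition "cinner_complex (x :: complex) (y :: complex) = x * cnj y"

instance
  by standard
    (auto simp: scaleC_complex_def cinner_complex_def algebra_simps scaleR_conv_of_real
       norm_mult complex_norm_square simp del: of_real_power)

end


section \<open>The algebra of continuous functions\<close>

text \<open>
  On a compact space every continuous function is bounded, so \<^typ>\<open>'x \<Rightarrow>\<^sub>C complex\<close>, with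
  the supremum norm of the library, is the algebra of all continuous functions.  The
  library provides no multiplication on it.
\<close>

lemma bcontfun_times:
  fixes f g :: "'a::topological_space \<Rightarrow>\<^sub>C 'b::real_normed_algebra"
  shows "(\<lambda>x. apply_bcontfun f x * apply_bcontfun g x) \<in> bcontfun"
proof (rule bcontfun_normI)
  fix x
  show "norm (apply_bcontfun f x * apply_bcontfun g x) \<le> norm f * norm g"
    by (rule order_trans[OF norm_mult_ineq]) (intro mult_mono norm_bounded norm_ge_zero)
qed (intro continuous_intros continuous_on_apply_bcontfun)

lemma bcontfun_scaleC:
  fixes f :: "'a::topological_space \<Rightarrow>\<^sub>C 'b::complex_normed_vector"
  shows "(\<lambda>x. c *\<^sub>C apply_bcontfun f x) \<in> bcontfun"
proof -
  have "bounded_linear (\<lambda>x::'b. c *\<^sub>C x)"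
  proof
    fix x y :: 'b and r :: real
    show "c *\<^sub>C (x + y) = c *\<^sub>C x + c *\<^sub>C y"
      by (rule scaleC_add_right)
    show "c *\<^sub>C (r *\<^sub>R x) = r *\<^sub>R (c *\<^sub>C x)"
      by (simp flip: scaleC_of_real add: scaleC_scaleC mult.commute)
    show "\<exists>K. \<forall>x::'b. norm (c *\<^sub>C x) \<le> norm x * K"
      by (rule exI[of _ "cmod c"]) (simp add: norm_scaleC mult.commute)
  qed
  then have "continuous_on UNIV (\<lambda>x. c *\<^sub>C apply_bcontfun f x)"
    by (rule bounded_linear.continuous_on) (rule continuous_on_apply_bcontfun)
  then show ?thesis
    by (rule bcontfun_normI[where b = "cmod c * norm f"])
      (simp add: norm_scaleC mult_left_mono norm_bounded)
qed

instantiation bcontfun :: (topological_space, real_normed_algebra_1) real_normed_algebra_1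
begin

definition "one_bcontfun = (const_bcontfun 1 :: ('a, 'b) bcontfun)"
definition "times_bcontfun f g =
  (Bcontfun (\<lambda>x. apply_bcontfun f x * apply_bcontfun g x) :: ('a, 'b) bcontfun)"

lemma apply_bcontfun_one [simp]: "apply_bcontfun (1 :: ('a, 'b) bcontfun) x = 1"
  by (simp add: one_bcontfun_def)

lemma apply_bcontfun_times [simp]:
  "apply_bcontfun (f * g :: ('a, 'b) bcontfun) x = apply_bcontfun f x * apply_bcontfun g x"
  by (simp add: times_bcontfun_def Bcontfun_inverse bcontfun_times)

instance
proof
  fix f g h :: "('a, 'b) bcontfun" and r :: real
  show "f * g * h = f * (g * h)" "(f + g) * h = f * h + g * h" "f * (g + h) = f * g + f * h"
    "1 * f = f" "f * 1 = f" "(r *\<^sub>R f) * g = r *\<^sub>R (f * g)" "f * (r *\<^sub>R g) = r *\<^sub>R (f * g)"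
    by (auto intro!: bcontfun_eqI simp: algebra_simps)
  show "(0 :: ('a, 'b) bcontfun) \<noteq> 1"
    by (metis apply_bcontfun_one zero_bcontfun.rep_eq zero_neq_one)
  show "norm (f * g) \<le> norm f * norm g"
  proof (rule norm_bound)
    fix x
    show "norm (apply_bcontfun (f * g) x) \<le> norm f * norm g"
      by simp (rule order_trans[OF norm_mult_ineq], intro mult_mono norm_bounded norm_ge_zero)
  qed
  show "norm (1 :: ('a, 'b) bcontfun) = 1"
  proof (rule antisym)
    show "norm (1 :: ('a, 'b) bcontfun) \<le> 1"
      by (rule norm_bound) simp
    show "1 \<le> norm (1 :: ('a, 'b) bcontfun)"
      using norm_bounded[of "1 :: ('a, 'b) bcontfun"] by simp
  qed
qed

end

instantiation bcontfun :: (topological_space, complex_normed_vector) complex_normed_vector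
begin

definition "scaleC_bcontfun c f =
  (Bcontfun (\<lambda>x. c *\<^sub>C apply_bcontfun f x) :: ('a, 'b) bcontfun)"

lemma apply_bcontfun_scaleC [simp]:
  "apply_bcontfun (c *\<^sub>C f :: ('a, 'b) bcontfun) x = c *\<^sub>C apply_bcontfun f x"
  by (simp add: scaleC_bcontfun_def Bcontfun_inverse bcontfun_scaleC)

instance
proof
  fix f g :: "('a, 'b) bcontfun" and a b :: complex and r :: real
  show "a *\<^sub>C (f + g) = a *\<^sub>C f + a *\<^sub>C g" "(a + b) *\<^sub>C f = a *\<^sub>C f + b *\<^sub>C f"
    and assoc: "a *\<^sub>C b *\<^sub>C f = (a * b) *\<^sub>C f"
    and of_real: "complex_of_real r *\<^sub>C f = r *\<^sub>R f"
    by (auto intro!: bcontfun_eqI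
        simp: scaleC_add_right scaleC_add_left scaleC_scaleC scaleC_of_real)
  have le: "norm (c *\<^sub>C k) \<le> cmod c * norm k" for c and k :: "('a, 'b) bcontfun"
    by (rule norm_bound) (simp add: norm_scaleC mult_left_mono norm_bounded)
  show "norm (a *\<^sub>C f) = cmod a * norm f"
  proof (cases "a = 0")
    case True
    then show ?thesis
      using le[of a f] by simp
  next
    case False
    have "inverse a *\<^sub>C a *\<^sub>C f = f"
      by (rule bcontfun_eqI) (use False scaleC_of_real[of 1] in \<open>simp add: scaleC_scaleC\<close>)
    then have "norm f \<le> cmod (inverse a) * norm (a *\<^sub>C f)"
      using le[of "inverse a" "a *\<^sub>C f"] by simp
    then have "cmod a * norm f \<le> norm (a *\<^sub>C f)"
      using False by (simp add: norm_inverse norm_divide field_simps)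
    with le[of a f] show ?thesis by simp
  qed
qed

end

definition uniform_algebra :: "('x::topological_space \<Rightarrow>\<^sub>C complex) set \<Rightarrow> bool" where
  "uniform_algebra A \<longleftrightarrow>
     1 \<in> A \<and> (\<forall>f\<in>A. \<forall>g\<in>A. f + g \<in> A) \<and> (\<forall>f\<in>A. \<forall>g\<in>A. f * g \<in> A) \<and>
     (\<forall>c. \<forall>f\<in>A. c *\<^sub>C f \<in> A) \<and> closed A"


section \<open>Bounded operators on a complex Hilbert space\<close>

text \<open>
  The library type \<^typ>\<open>'h \<Rightarrow>\<^sub>L 'h\<close> consists of the bounded real-linear operators; its norm
  is the operator norm.
\<close>

definition bounded_operators :: "('h::complex_hilbert_space \<Rightarrow>\<^sub>L 'h) set" where
  "bounded_operators = {T. \<forall>c x. blinfun_apply T (c *\<^sub>C x) = c *\<^sub>C blinfun_apply T x}"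

definition cadjoint :: "('h::complex_hilbert_space \<Rightarrow>\<^sub>L 'h) \<Rightarrow> ('h \<Rightarrow>\<^sub>L 'h)" where
  "cadjoint T =
     (THE S. \<forall>x y. cinner (blinfun_apply T x) y = cinner x (blinfun_apply S y))"

text \<open>
  The adjoint is given by a definite description; the facts below, which include the
  Riesz representation theorem, show that it exists and is unique on the complex-linear
  operators.
\<close>

lemma cinner_add_right:
  fixes x :: "'h::complex_hilbert_space"
  shows "cinner x (y + z) = cinner x y + cinner x z"
  by (metis cinner_commute cinner_add_left complex_cnj_add)

lemma cinner_scaleC_right:
  fixes x :: "'h::complex_hilbert_space"
  shows "cinner x (a *\<^sub>C y) = cnj a * cinner x y"
  by (metis cinner_commute cinner_scaleC_left complex_cnj_mult)

lemma cinner_scaleR_left: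
  fixes x :: "'h::complex_hilbert_space"
  shows "cinner (r *\<^sub>R x) y = complex_of_real r * cinner x y"
  by (simp flip: scaleC_of_real add: cinner_scaleC_left)

lemma cinner_scaleR_right:
  fixes x :: "'h::complex_hilbert_space"
  shows "cinner x (r *\<^sub>R y) = complex_of_real r * cinner x y"
  by (simp flip: scaleC_of_real add: cinner_scaleC_right)

lemma cinner_minus_left:
  fixes x :: "'h::complex_hilbert_space"
  shows "cinner (- x) y = - cinner x y"
  using cinner_scaleR_left[of "-1" x y] by simp

lemma cinner_minus_right:
  fixes x :: "'h::complex_hilbert_space"
  shows "cinner x (- y) = - cinner x y"
  using cinner_scaleR_right[of x "-1" y] by simp

lemma cinner_diff_right:
  fixes x :: "'h::complex_hilbert_space"
  shows "cinner x (y - z) = cinner x y - cinner x z"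
  using cinner_add_right[of x "y - z" z] by simp

lemma cinner_eqI:
  fixes y z :: "'h::complex_hilbert_space"
  assumes "\<And>x. cinner x y = cinner x z"
  shows "y = z"
proof -
  have "complex_of_real ((norm (y - z))\<^sup>2) = 0"
    unfolding cinner_self[symmetric] cinner_diff_right by (simp add: assms)
  then show ?thesis by simp
qed

lemma norm_add_square:
  fixes x :: "'h::complex_hilbert_space"
  shows "(norm (x + y))\<^sup>2 = (norm x)\<^sup>2 + (norm y)\<^sup>2 + 2 * Re (cinner x y)"
proof -
  have "complex_of_real ((norm (x + y))\<^sup>2) =
      complex_of_real ((norm x)\<^sup>2) + complex_of_real ((norm y)\<^sup>2) + cinner x y + cnj (cinner x y)"
    unfolding cinner_self[symmetric] cinner_add_left cinner_add_right
    using cinner_commute[of y x] by simp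
  then have "Re (complex_of_real ((norm (x + y))\<^sup>2)) = Re (complex_of_real ((norm x)\<^sup>2) +
      complex_of_real ((norm y)\<^sup>2) + cinner x y + cnj (cinner x y))"
    by simp
  then show ?thesis by simp
qed

lemma Re_cinner_le:
  fixes x :: "'h::complex_hilbert_space"
  shows "Re (cinner x y) \<le> norm x * norm y"
proof -
  have "(norm (x + y))\<^sup>2 \<le> (norm x + norm y)\<^sup>2"
    by (intro power_mono norm_triangle_ineq norm_ge_zero)
  then show ?thesis
    unfolding norm_add_square by (simp add: power2_sum)
qed

lemma parallelogram_law:
  fixes x :: "'h::complex_hilbert_space"
  shows "(norm (x + y))\<^sup>2 + (norm (x - y))\<^sup>2 = 2 * (norm x)\<^sup>2 + 2 * (norm y)\<^sup>2"
  using norm_add_square[of x y] norm_add_square[of x "- y"]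
  by (simp add: cinner_minus_right)

lemma riesz_representation:
  fixes f :: "'h::complex_hilbert_space \<Rightarrow> complex"
  assumes f: "bounded_linear f" and fC: "\<And>c x. f (c *\<^sub>C x) = c * f x"
  shows "\<exists>z. \<forall>x. f x = cinner x z"
proof -
  interpret f: bounded_linear f by (rule f)
  define J where "J x = (norm x)\<^sup>2 - 2 * Re (f x)" for x
  obtain K where K: "\<And>x. norm (f x) \<le> norm x * K"
    using f.bounded by blast
  have lower: "- (K\<^sup>2) \<le> J x" for x
  proof -
    have "Re (f x) \<le> norm x * K"
      using K[of x] complex_Re_le_cmod[of "f x"] by linarith
    moreover have "0 \<le> (norm x - K)\<^sup>2" by simp
    ultimately show ?thesis
      unfolding J_def power2_diff by linarith
  qed
  define m where "m = Inf (range J)"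
  have bdd: "bdd_below (range J)"
    using lower by (auto intro!: bdd_belowI)
  have m_le: "m \<le> J x" for x
    unfolding m_def by (rule cInf_lower[OF _ bdd]) simp
  have "\<exists>x. J x < m + 1 / Suc n" for n
  proof -
    have "Inf (range J) < m + 1 / Suc n" by (simp add: m_def)
    then show ?thesis
      using cInf_less_iff[OF _ bdd] by auto
  qed
  then obtain X where X: "\<And>n. J (X n) < m + 1 / Suc n" by metis
  have mid: "(norm (a - b))\<^sup>2 \<le> 2 * (J a - m) + 2 * (J b - m)" for a b
  proof -
    have "J ((1 / 2) *\<^sub>R (a + b)) = (norm (a + b))\<^sup>2 / 4 - Re (f a) - Re (f b)"
      unfolding J_def by (simp add: f.scaleR f.add power_divide add_divide_distrib del: scaleR_add_right scaleR_right_distrib)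
    then have "4 * m \<le> (norm (a + b))\<^sup>2 - 4 * Re (f a) - 4 * Re (f b)"
      using m_le[of "(1 / 2) *\<^sub>R (a + b)"] by simp
    then show ?thesis
      using parallelogram_law[of a b] unfolding J_def right_diff_distrib by linarith
  qed
  have "Cauchy X"
  proof (rule CauchyI)
    fix e :: real
    assume "0 < e"
    then obtain M where M: "inverse (real (Suc M)) < e\<^sup>2 / 4"
      using reals_Archimedean[of "e\<^sup>2 / 4"] by auto
    have small: "J (X n) - m < e\<^sup>2 / 4" if "M \<le> n" for n
    proof -
      have "1 / real (Suc n) \<le> inverse (real (Suc M))"
        using that by (simp add: field_simps)
      with X[of n] M show ?thesis by linarith
    qed
    have "norm (X i - X j) < e" if "M \<le> i" "M \<le> j" for i j
    proof (rule power2_less_imp_less)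
      show "(norm (X i - X j))\<^sup>2 < e\<^sup>2"
        using mid[of "X i" "X j"] small[OF that(1)] small[OF that(2)]
          unfolding right_diff_distrib by linarith
    qed (use \<open>0 < e\<close> in simp)
    then show "\<exists>M. \<forall>i\<ge>M. \<forall>j\<ge>M. norm (X i - X j) < e" by blast
  qed
  then obtain z where z: "X \<longlonglongrightarrow> z"
    using Cauchy_convergent convergent_def by blast
  have "(\<lambda>n. J (X n)) \<longlonglongrightarrow> J z"
    unfolding J_def by (intro tendsto_intros f.tendsto z)
  moreover have "(\<lambda>n. m + 1 / real (Suc n)) \<longlonglongrightarrow> m + 0"
    using LIMSEQ_inverse_real_of_nat
    by (intro tendsto_add tendsto_const) (simp add: inverse_eq_divide)
  ultimately have "J z \<le> m + 0"
    by (rule LIMSEQ_le) (use X in \<open>auto intro: less_imp_le\<close>)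
  then have min: "J z \<le> J x" for x
    using m_le[of x] by simp
  have Re_eq: "Re (f v) = Re (cinner v z)" for v
  proof -
    define d where "d = Re (cinner z v) - Re (f v)"
    have quad: "0 \<le> t\<^sup>2 * (norm v)\<^sup>2 + 2 * t * d" for t
    proof -
      have "J (z + t *\<^sub>R v) = J z + t\<^sup>2 * (norm v)\<^sup>2 + 2 * t * d"
        unfolding J_def norm_add_square d_def
        by (simp add: f.add f.scaleR cinner_scaleR_right power_mult_distrib algebra_simps)
      with min[of "z + t *\<^sub>R v"] show ?thesis by simp
    qed
    define s where "s = 1 + (norm v)\<^sup>2"
    have s: "s > 0" unfolding s_def by (simp add: add_pos_nonneg)
    have "0 \<le> (- d / s)\<^sup>2 * (norm v)\<^sup>2 + 2 * (- d / s) * d"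
      by (rule quad)
    also have "\<dots> \<le> (- d / s)\<^sup>2 * s + 2 * (- d / s) * d"
      unfolding s_def by (intro add_right_mono mult_left_mono) auto
    also have "\<dots> = - (d\<^sup>2 / s)"
      using s by (simp add: field_simps power2_eq_square)
    finally have "d\<^sup>2 / s \<le> 0" by simp
    then have "d = 0"
      using s by (simp add: divide_le_0_iff)
    then show ?thesis
      using cinner_commute[of z v] by (simp add: d_def)
  qed
  have "f v = cinner v z" for v
    using Re_eq[of v] Re_eq[of "\<i> *\<^sub>C v"]
    by (simp add: fC cinner_scaleC_left complex_eq_iff)
  then show ?thesis by blast
qed

lemma cadjoint_exists:
  fixes T :: "'h::complex_hilbert_space \<Rightarrow>\<^sub>L 'h"
  assumes "T \<in> bounded_operators"
  shows "\<exists>!S. \<forall>x y. cinner (blinfun_apply T x) y = cinner x (blinfun_apply S y)"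
proof -
  have TC: "blinfun_apply T (c *\<^sub>C x) = c *\<^sub>C blinfun_apply T x" for c x
    using assms by (simp add: bounded_operators_def)
  have bl: "bounded_linear (\<lambda>x. cinner x y)" for y :: 'h
  proof (rule bounded_linear_intro)
    show "norm (cinner x y) \<le> norm x * (2 * norm y)" for x
    proof -
      have Re: "\<bar>Re (cinner w y)\<bar> \<le> norm w * norm y" for w
        using Re_cinner_le[of w y] Re_cinner_le[of "- w" y]
        by (simp add: cinner_minus_left)
      have "\<bar>Im (cinner x y)\<bar> \<le> norm x * norm y"
        using Re[of "\<i> *\<^sub>C x"] by (simp add: cinner_scaleC_left norm_scaleC)
      with Re[of x] show ?thesis
        using cmod_le[of "cinner x y"] by simp
    qed
  qed (simp_all add: cinner_add_left cinner_scaleR_left scaleR_conv_of_real)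
  have "\<exists>z. \<forall>x. cinner (blinfun_apply T x) y = cinner x z" for y
    by (rule riesz_representation)
      (auto intro: bounded_linear_compose[OF bl] blinfun.bounded_linear_right
        simp: TC cinner_scaleC_left)
  then obtain S where S: "\<And>x y. cinner (blinfun_apply T x) y = cinner x (S y)"
    by metis
  have "bounded_linear S"
  proof (rule bounded_linear_intro)
    show "S (x + y) = S x + S y" for x y
      by (rule cinner_eqI) (simp flip: S add: cinner_add_right)
    show "S (r *\<^sub>R x) = r *\<^sub>R S x" for r x
      by (rule cinner_eqI) (simp flip: S add: cinner_scaleR_right)
    show "norm (S y) \<le> norm y * norm T" for y
    proof (cases "S y = 0")
      case False
      have "(norm (S y))\<^sup>2 = Re (cinner (blinfun_apply T (S y)) y)"
        by (simp add: S cinner_self del: of_real_power)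
      also have "\<dots> \<le> norm (blinfun_apply T (S y)) * norm y"
        by (rule Re_cinner_le)
      also have "\<dots> \<le> norm T * norm (S y) * norm y"
        by (intro mult_right_mono norm_blinfun norm_ge_zero)
      finally have "norm (S y) * norm (S y) \<le> norm (S y) * (norm y * norm T)"
        by (simp add: power2_eq_square algebra_simps)
      then show ?thesis
        using False by simp
    qed simp
  qed
  then have "\<forall>x y. cinner (blinfun_apply T x) y = cinner x (blinfun_apply (Blinfun S) y)"
    by (simp add: bounded_linear_Blinfun_apply S)
  moreover have "S1 = S2"
    if "\<forall>x y. cinner (blinfun_apply T x) y = cinner x (blinfun_apply S1 y)"
      and "\<forall>x y. cinner (blinfun_apply T x) y = cinner x (blinfun_apply S2 y)" for S1 S2
    by (rule blinfun_eqI, rule cinner_eqI) (use that in metis)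
  ultimately show ?thesis by blast
qed

lemma cadjoint:
  fixes T :: "'h::complex_hilbert_space \<Rightarrow>\<^sub>L 'h"
  assumes "T \<in> bounded_operators"
  shows "cinner (blinfun_apply T x) y = cinner x (blinfun_apply (cadjoint T) y)"
  using theI'[OF cadjoint_exists[OF assms]] unfolding cadjoint_def by blast

lemma cadjoint_in_bounded_operators:
  fixes T :: "'h::complex_hilbert_space \<Rightarrow>\<^sub>L 'h"
  assumes "T \<in> bounded_operators"
  shows "cadjoint T \<in> bounded_operators"
proof -
  have "blinfun_apply (cadjoint T) (c *\<^sub>C y) = c *\<^sub>C blinfun_apply (cadjoint T) y" for c y
    by (rule cinner_eqI) (simp only: cadjoint[OF assms, symmetric] cinner_scaleC_right)
  then show ?thesis
    by (simp add: bounded_operators_def)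
qed

definition unital_homomorphism_on ::
    "('x::topological_space \<Rightarrow>\<^sub>C complex) set \<Rightarrow>
     (('x \<Rightarrow>\<^sub>C complex) \<Rightarrow> ('h::complex_hilbert_space \<Rightarrow>\<^sub>L 'h)) \<Rightarrow> bool" where
  "unital_homomorphism_on A \<theta> \<longleftrightarrow>
     (\<forall>f\<in>A. \<theta> f \<in> bounded_operators) \<and>
     (\<forall>f\<in>A. \<forall>g\<in>A. \<theta> (f + g) = \<theta> f + \<theta> g) \<and>
     (\<forall>c. \<forall>f\<in>A. \<forall>x. blinfun_apply (\<theta> (c *\<^sub>C f)) x = c *\<^sub>C blinfun_apply (\<theta> f) x) \<and>
     (\<forall>f\<in>A. \<forall>g\<in>A. \<theta> (f * g) = \<theta> f o\<^sub>L \<theta> g) \<and>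
     \<theta> 1 = id_blinfun"

definition unital_antilinear_on ::
    "('x::topological_space \<Rightarrow>\<^sub>C complex) set \<Rightarrow>
     (('x \<Rightarrow>\<^sub>C complex) \<Rightarrow> ('x \<Rightarrow>\<^sub>C complex)) \<Rightarrow> bool" where
  "unital_antilinear_on A \<alpha> \<longleftrightarrow>
     (\<forall>f\<in>A. \<alpha> f \<in> A) \<and>
     (\<forall>f\<in>A. \<forall>g\<in>A. \<alpha> (f + g) = \<alpha> f + \<alpha> g) \<and>
     (\<forall>c. \<forall>f\<in>A. \<alpha> (c *\<^sub>C f) = cnj c *\<^sub>C \<alpha> f) \<and>
     \<alpha> 1 = 1"

definition bounded_map_on :: "'a::real_normed_vector set \<Rightarrow> ('a \<Rightarrow> 'b::real_normed_vector) \<Rightarrow> bool"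
  where "bounded_map_on A F \<longleftrightarrow> (\<exists>C. \<forall>h\<in>A. norm (F h) \<le> C * norm h)"

definition Phi ::
    "(('x::topological_space \<Rightarrow>\<^sub>C complex) \<Rightarrow> ('h::complex_hilbert_space \<Rightarrow>\<^sub>L 'h)) \<Rightarrow>
     (('x \<Rightarrow>\<^sub>C complex) \<Rightarrow> ('x \<Rightarrow>\<^sub>C complex)) \<Rightarrow>
     ('x \<Rightarrow>\<^sub>C complex) \<Rightarrow> ('h \<Rightarrow>\<^sub>L 'h)" where
  "Phi \<theta> \<alpha> h = (1 / 2) *\<^sub>R (\<theta> h + cadjoint (\<theta> (\<alpha> h)))"

end

theory Submission
  imports Defs
begin

text \<open>
  It suffices to show \<open>K := \<parallel>T\<parallel> \<le> 2\<close> for \<open>T = \<theta> f\<close> with \<open>\<parallel>f\<parallel> \<le> 1\<close>.  Two properties of the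
  operators \<open>E\<^sub>m = \<Phi> (f ^ m)\<close> are used.

  First, \<open>2 E\<^sub>m = T ^ m + G\<^sub>m\<^sup>*\<close>, where \<open>G\<^sub>m = \<theta> (\<alpha> (f ^ m))\<close> commutes with \<open>T\<close>.  If \<open>x\<close> is a unit
  vector at which \<open>T\<close> attains its norm, then \<open>T\<^sup>* T x = K\<^sup>2 x\<close>, and the commutation gives
  \<open>\<langle>G\<^sub>m\<^sup>* T x, T ^ (m + 1) x\<rangle> = K\<^sup>2 \<langle>G\<^sub>m\<^sup>* x, T ^ m x\<rangle>\<close>.

  Secondly, \<open>\<Phi>\<close> is unital and contractive, so it maps functions with nonnegative real part to
  accretive operators, and therefore the operator Toeplitz matrix with entries \<open>E\<^bsub>l - k\<^esub>\<close>
  (and adjoints above the diagonal) is positive (\<open>toeplitz_form_nonneg\<close>).  In other words,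
  \<open>m \<mapsto> E\<^sub>m\<close> has a unitary dilation.

  The estimate comes from testing this positivity on the vectors \<open>s\<^sub>0 = x\<close> and \<open>s\<^sub>k = - u\<^sub>k\<close> for
  \<open>k \<ge> 1\<close>, with \<open>u\<^sub>k = K ^ (- k) T ^ k x\<close>.  By the first property, the unknown terms
  with \<open>G\<^sub>l\<close> in the pair \<open>(s\<^sub>0, s\<^sub>l)\<close> cancel against those in the pair \<open>(s\<^sub>1, s\<^bsub>l + 1\<^esub>)\<close>; as the powers
  of \<open>f\<close> stay in the unit ball and \<open>\<theta>\<close>, \<open>\<alpha>\<close> are bounded, the one term that is left in a finite
  section decays like \<open>K ^ (- n)\<close>.  What remains is
  \<open>1 - (K - 1) \<parallel>u\<^sub>1\<parallel>\<^sup>2 - (\<Sum>l\<ge>2. (K ^ l - K ^ (l - 1)) \<parallel>u\<^sub>l\<parallel>\<^sup>2)\<close> plus the Toeplitz form of \<open>(u\<^sub>l)\<close>,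
  \<open>l \<ge> 2\<close>.  Since the \<open>E\<^sub>m\<close> are contractions, that form is at most \<open>(\<Sum>l\<ge>2. \<parallel>u\<^sub>l\<parallel>)\<^sup>2\<close>, which by the
  Cauchy-Schwarz inequality the sum absorbs as soon as \<open>K \<ge> 2\<close>.  As \<open>\<parallel>u\<^sub>1\<parallel> = 1\<close>, this gives
  \<open>0 \<le> 2 - K\<close>.  In infinite dimension \<open>x\<close> is only nearly norming; the error is controlled
  through the positive form \<open>K\<^sup>2 \<langle>v, v'\<rangle> - \<langle>T v, T v'\<rangle>\<close> (\<open>norm_le_two_aux\<close>), and a limit is
  taken (\<open>norm_le_two\<close>).
\<close>

section \<open>Inner products and trigonometric sums\<close>

lemma cinner_zero_left [simp]:
  fixes y :: "'h::complex_hilbert_space"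
  shows "cinner 0 y = 0"
  using cinner_scaleR_left[of 0 0 y] by simp

lemma cinner_zero_right [simp]:
  fixes x :: "'h::complex_hilbert_space"
  shows "cinner x 0 = 0"
  using cinner_scaleR_right[of x 0 0] by simp

lemma cinner_sum_left:
  fixes y :: "'h::complex_hilbert_space"
  shows "cinner (\<Sum>i\<in>I. f i) y = (\<Sum>i\<in>I. cinner (f i) y)"
  by (induction I rule: infinite_finite_induct) (simp_all add: cinner_add_left)

lemma cinner_sum_right:
  fixes x :: "'h::complex_hilbert_space"
  shows "cinner x (\<Sum>i\<in>I. f i) = (\<Sum>i\<in>I. cinner x (f i))"
  by (induction I rule: infinite_finite_induct) (simp_all add: cinner_add_right)

lemma Re_cinner_commute:
  fixes x :: "'h::complex_hilbert_space"
  shows "Re (cinner x y) = Re (cinner y x)"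
  using cinner_commute[of x y] by simp

lemma abs_Re_cinner_le:
  fixes x :: "'h::complex_hilbert_space"
  shows "\<bar>Re (cinner x y)\<bar> \<le> norm x * norm y"
  using Re_cinner_le[of x y] Re_cinner_le[of "- x" y] by (simp add: cinner_minus_left)

lemma sum_powers_root_of_unity:
  assumes "p < M" and "q < M"
  defines "z \<equiv> \<lambda>j. cis (2 * pi * real j / real M)"
  shows "(\<Sum>j<M. z j ^ p * cnj (z j ^ q)) = (if p = q then of_nat M else 0)"
proof -
  define w where "w = cis (2 * pi * (real p - real q) / real M)"
  have M: "M > 0" using assms by simp
  have summand: "z j ^ p * cnj (z j ^ q) = w ^ j" for j
    unfolding z_def w_def Complex.DeMoivre cis_cnj cis_mult
    by (simp add: algebra_simps diff_divide_distrib)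
  show ?thesis
  proof (cases "p = q")
    case True
    then have "w = 1" by (simp add: w_def)
    with True show ?thesis unfolding summand by simp
  next
    case False
    have wM: "w ^ M = 1"
    proof -
      have "w ^ M = cis (2 * pi * of_int (int p - int q))"
        using M by (simp add: w_def Complex.DeMoivre)
      also have "\<dots> = 1" by (rule cis_multiple_2pi) simp
      finally show ?thesis .
    qed
    have w1: "w \<noteq> 1"
    proof
      assume "w = 1"
      then have "cos (2 * pi * (real p - real q) / real M) = 1"
        by (simp add: w_def complex_eq_iff)
      then obtain n :: int where "2 * pi * (real p - real q) / real M = of_int n * 2 * pi"
        unfolding cos_one_2pi_int by auto
      then have "2 * pi * ((real p - real q) / real M) = 2 * pi * of_int n"
        by simp
      then have "(real p - real q) / real M = of_int n"
        by (simp only: mult_cancel_left) simp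
      then have "real p - real q = of_int n * real M"
        using M by (simp add: field_simps)
      then have "real_of_int (int p - int q) = real_of_int (n * int M)"
        by simp
      then have eq: "int p - int q = n * int M"
        by (simp only: of_int_eq_iff)
      have "\<bar>int p - int q\<bar> < int M" using assms by linarith
      then have "\<bar>n\<bar> * int M < 1 * int M" using eq by (simp add: abs_mult)
      then have "n = 0" using mult_less_cancel_right[of "\<bar>n\<bar>" "int M" 1] by linarith
      with eq False show False by simp
    qed
    have "(\<Sum>j<M. w ^ j) = (w ^ M - 1) / (w - 1)"
      by (rule geometric_sum[OF w1])
    with False wM show ?thesis unfolding summand by simp
  qed
qed

text \<open>
  For \<open>\<bar>z\<bar> = 1\<close> the sum is \<open>N\<close> times the Fejer kernel of order \<open>N\<close>.  With \<open>S l\<close> the geometric sum of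
  length \<open>l\<close>, so that \<open>S (l + 1) = 1 + z * S l\<close>, each summand dominates the increment of
  \<open>\<bar>S l\<bar>\<^sup>2\<close>.
\<close>

lemma Re_fejer_sum_nonneg:
  fixes z :: complex
  assumes "cmod z \<le> 1"
  shows "0 \<le> (\<Sum>l<N. 2 * Re (\<Sum>m\<le>l. z ^ m) - 1)"
proof -
  define S where "S l = (\<Sum>m<l. z ^ m)" for l
  have step: "(cmod (S (Suc l)))\<^sup>2 - (cmod (S l))\<^sup>2 \<le> 2 * Re (S (Suc l)) - 1" for l
  proof -
    have eq: "S (Suc l) = 1 + z * S l"
      unfolding S_def sum.lessThan_Suc_shift by (simp add: sum_distrib_left)
    have "(cmod (z * S l))\<^sup>2 \<le> (cmod (S l))\<^sup>2"
      using assms by (intro power_mono) (simp_all add: norm_mult mult_left_le_one_le)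
    moreover have "(cmod (1 + z * S l))\<^sup>2 = 1 + 2 * Re (z * S l) + (cmod (z * S l))\<^sup>2"
      by (simp only: cmod_power2 plus_complex.sel one_complex.sel) algebra
    ultimately show ?thesis unfolding eq by simp
  qed
  have "(cmod (S N))\<^sup>2 - (cmod (S 0))\<^sup>2 \<le> (\<Sum>l<N. 2 * Re (S (Suc l)) - 1)"
    unfolding sum_lessThan_telescope[of "\<lambda>l. (cmod (S l))\<^sup>2", symmetric]
    by (intro sum_mono step)
  then have "(cmod (S N))\<^sup>2 \<le> (\<Sum>l<N. 2 * Re (S (Suc l)) - 1)"
    by (simp add: S_def)
  then show ?thesis
    unfolding S_def lessThan_Suc_atMost using zero_le_power2 order_trans by blast
qed

lemma nonneg_if_partial_sums_nonneg:
  fixes a :: "nat \<Rightarrow> real"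
  assumes partial: "\<And>N. 0 \<le> (\<Sum>l<N. a l)" and const: "\<And>l. n \<le> l \<Longrightarrow> a l = c"
  shows "0 \<le> c"
proof (rule ccontr)
  assume "\<not> 0 \<le> c"
  have sum: "(\<Sum>l<n + k. a l) = (\<Sum>l<n. a l) + real k * c" for k
    by (induction k) (simp_all add: const algebra_simps)
  obtain k where "(\<Sum>l<n. a l) < real k * (- c)"
    using reals_Archimedean3[of "- c"] \<open>\<not> 0 \<le> c\<close> by auto
  with sum[of k] partial[of "n + k"] show False by simp
qed


section \<open>Positivity of unital contractions on a uniform algebra\<close>

text \<open>
  The quadratic form at \<open>(s 0, \<dots>, s (n - 1))\<close> of the self-adjoint operator Toeplitz matrix with
  identity diagonal and entries \<open>E (l - k)\<close> for \<open>k < l\<close>.  The value \<open>E 0\<close> does not enter.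
\<close>

definition toeplitz_form ::
    "(nat \<Rightarrow> 'h::complex_hilbert_space \<Rightarrow>\<^sub>L 'h) \<Rightarrow> (nat \<Rightarrow> 'h) \<Rightarrow> nat \<Rightarrow> real" where
  "toeplitz_form E s n =
     (\<Sum>l<n. (norm (s l))\<^sup>2 + 2 * (\<Sum>k<l. Re (cinner (blinfun_apply (E (l - k)) (s k)) (s l))))"

text \<open>A complex-linear unital contraction from a uniform algebra into the complex-linear operators.\<close>

locale unital_contraction =
  fixes A :: "('x::topological_space \<Rightarrow>\<^sub>C complex) set"
    and F :: "('x \<Rightarrow>\<^sub>C complex) \<Rightarrow> ('h::complex_hilbert_space \<Rightarrow>\<^sub>L 'h)"
  assumes algebra: "uniform_algebra A"
    and range: "\<And>h. h \<in> A \<Longrightarrow> F h \<in> bounded_operators"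
    and add: "\<And>g h. g \<in> A \<Longrightarrow> h \<in> A \<Longrightarrow> F (g + h) = F g + F h"
    and scale: "\<And>c h u. h \<in> A \<Longrightarrow>
      blinfun_apply (F (c *\<^sub>C h)) u = c *\<^sub>C blinfun_apply (F h) u"
    and one: "F 1 = id_blinfun"
    and contractive: "\<And>h. h \<in> A \<Longrightarrow> norm (F h) \<le> norm h"
begin

lemma one_mem: "1 \<in> A" and add_mem: "g \<in> A \<Longrightarrow> h \<in> A \<Longrightarrow> g + h \<in> A"
  and mult_mem: "g \<in> A \<Longrightarrow> h \<in> A \<Longrightarrow> g * h \<in> A" and scale_mem: "h \<in> A \<Longrightarrow> c *\<^sub>C h \<in> A"
  using algebra by (simp_all add: uniform_algebra_def)

lemma apply_scaleC:
  "h \<in> A \<Longrightarrow> blinfun_apply (F h) (c *\<^sub>C u) = c *\<^sub>C blinfun_apply (F h) u"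
  using range by (simp add: bounded_operators_def)

lemma zero_mem: "0 \<in> A"
  using scale_mem[OF one_mem, of "complex_of_real 0"] unfolding scaleC_of_real by simp

lemma power_mem: "h \<in> A \<Longrightarrow> h ^ m \<in> A"
  by (induction m) (simp_all add: one_mem mult_mem)

lemma sum_mem: "(\<And>i. i \<in> I \<Longrightarrow> g i \<in> A) \<Longrightarrow> (\<Sum>i\<in>I. g i) \<in> A"
  by (induction I rule: infinite_finite_induct) (simp_all add: zero_mem add_mem)

lemma zero: "F 0 = 0"
  using add[OF zero_mem zero_mem] by simp

lemma sum: "(\<And>i. i \<in> I \<Longrightarrow> g i \<in> A) \<Longrightarrow> F (\<Sum>i\<in>I. g i) = (\<Sum>i\<in>I. F (g i))"
  by (induction I rule: infinite_finite_induct) (simp_all add: zero add sum_mem)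

text \<open>
  Contractivity, tested on \<open>1 - t h\<close> for small \<open>t > 0\<close>: if \<open>Re h \<ge> 0\<close>, then the norm of this
  function exceeds 1 by at most a multiple of \<open>t\<^sup>2\<close>.
\<close>

lemma accretive:
  assumes h: "h \<in> A" and Re: "\<And>x. 0 \<le> Re (apply_bcontfun h x)"
  shows "0 \<le> Re (cinner (blinfun_apply (F h) v) v)"
proof -
  define r where "r = Re (cinner (blinfun_apply (F h) v) v)"
  define c where "c = (norm h)\<^sup>2 * (norm v)\<^sup>2"
  have "- r \<le> c * t" if t: "0 < t" for t
  proof -
    define g where "g = 1 + complex_of_real (- t) *\<^sub>C h"
    have g: "g \<in> A" unfolding g_def by (intro add_mem one_mem scale_mem h)
    have "norm g \<le> 1 + t\<^sup>2 * (norm h)\<^sup>2"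
    proof (rule norm_bound)
      fix x
      define w where "w = apply_bcontfun h x"
      have gx: "apply_bcontfun g x = 1 - complex_of_real t * w"
        by (simp add: g_def w_def scaleC_complex_def)
      have w: "cmod w \<le> norm h" unfolding w_def by (rule norm_bounded)
      have "(cmod (1 - complex_of_real t * w))\<^sup>2 = 1 - 2 * t * Re w + t\<^sup>2 * (cmod w)\<^sup>2"
        unfolding cmod_power2 by simp algebra
      also have "\<dots> \<le> 1 + t\<^sup>2 * (norm h)\<^sup>2"
      proof -
        have "0 \<le> t * Re w" using Re[of x] t by (simp add: w_def)
        moreover have "t\<^sup>2 * (cmod w)\<^sup>2 \<le> t\<^sup>2 * (norm h)\<^sup>2"
          by (intro mult_left_mono power_mono w) simp_all
        ultimately show ?thesis by simp
      qed
      also have "\<dots> \<le> (1 + t\<^sup>2 * (norm h)\<^sup>2)\<^sup>2"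
        by (intro self_le_power) auto
      finally show "norm (apply_bcontfun g x) \<le> 1 + t\<^sup>2 * (norm h)\<^sup>2"
        unfolding gx by (rule power2_le_imp_le) simp
    qed
    then have Fg: "norm (F g) \<le> 1 + t\<^sup>2 * (norm h)\<^sup>2"
      using contractive[OF g] by linarith
    have "(norm v)\<^sup>2 - t * r = Re (cinner (blinfun_apply (F g) v) v)"
      unfolding g_def r_def
      by (simp add: add one_mem scale_mem h one blinfun.add_left scale cinner_add_left
          cinner_scaleC_left cinner_self cinner_minus_left del: of_real_power)
    also have "\<dots> \<le> norm (blinfun_apply (F g) v) * norm v" by (rule Re_cinner_le)
    also have "\<dots> \<le> (norm (F g) * norm v) * norm v"
      by (intro mult_right_mono norm_blinfun norm_ge_zero)
    also have "\<dots> \<le> ((1 + t\<^sup>2 * (norm h)\<^sup>2) * norm v) * norm v"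
      by (intro mult_right_mono Fg norm_ge_zero)
    also have "\<dots> = (norm v)\<^sup>2 + t * (c * t)"
      by (simp add: c_def power2_eq_square algebra_simps)
    finally have "t * (- r) \<le> t * (c * t)" by simp
    with t show "- r \<le> c * t" by (simp only: mult_le_cancel_left_pos)
  qed
  then have "\<forall>\<^sub>F t in at_right 0. - r \<le> c * t"
    unfolding eventually_at_right_field by (intro exI[of _ 1]) simp
  moreover have "((\<lambda>t. c * t) \<longlongrightarrow> c * 0) (at_right 0)"
    by (intro tendsto_intros)
  ultimately have "- r \<le> c * 0"
    by (intro tendsto_lowerbound[of _ _ "at_right (0::real)"]) simp_all
  then show ?thesis by (simp add: r_def)
qed

text \<open>
  The function \<open>\<Sum>L<N. 2 (\<Sum>m\<le>L. (\<zeta> f) ^ m) - 1\<close> has nonnegative real part for each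
  \<open>\<zeta>\<close> on the unit circle.  By accretivity of its image, evaluated at the vector
  \<open>\<xi> = (\<Sum>k<n. \<zeta> ^ k s k)\<close> and averaged over the \<open>M\<close>-th roots of unity \<open>\<zeta>\<close>, the partial sums of
  a sequence \<open>a\<close> are nonnegative, and \<open>a\<close> is eventually equal to the Toeplitz form.
\<close>

lemma toeplitz_form_nonneg:
  assumes f: "f \<in> A" and norm_f: "norm f \<le> 1"
  shows "0 \<le> toeplitz_form (\<lambda>m. F (f ^ m)) s n"
proof -
  define e where "e m k l = cinner (blinfun_apply (F (f ^ m)) (s k)) (s l)" for m k l
  \<comment> \<open>the contribution of the \<open>m\<close>-th diagonal to the form\<close>
  define P where "P m = (\<Sum>l<n. \<Sum>k<n. if m + k = l then e m k l else 0)" for m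
  define a where "a L = 2 * Re (\<Sum>m\<le>L. P m) - Re (P 0)" for L
  have P0: "P 0 = (\<Sum>l<n. complex_of_real ((norm (s l))\<^sup>2))"
    unfolding P_def e_def by (simp add: one cinner_self sum.delta del: of_real_power)
  have const: "a L = toeplitz_form (\<lambda>m. F (f ^ m)) s n" if L: "n \<le> L" for L
  proof -
    have "(\<Sum>m\<le>L. P m) = (\<Sum>l<n. \<Sum>k<n. \<Sum>m\<le>L. if m + k = l then e m k l else 0)"
      unfolding P_def by (subst sum.swap, rule sum.cong[OF refl], subst sum.swap) (rule refl)
    also have "\<dots> = (\<Sum>l<n. \<Sum>k<n. if k \<le> l then e (l - k) k l else 0)"
    proof (intro sum.cong refl)
      fix l k assume "l \<in> {..<n}" "k \<in> {..<n}"
      have "(\<Sum>m\<le>L. if m + k = l then e m k l else 0) =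
          (\<Sum>m\<le>L. if m = l - k then (if k \<le> l then e m k l else 0) else 0)"
        by (intro sum.cong) auto
      also have "\<dots> = (if k \<le> l then e (l - k) k l else 0)"
        using L \<open>l \<in> _\<close> by (subst sum.delta) auto
      finally show "(\<Sum>m\<le>L. if m + k = l then e m k l else 0) =
          (if k \<le> l then e (l - k) k l else 0)" .
    qed
    also have "\<dots> = (\<Sum>l<n. \<Sum>k\<le>l. e (l - k) k l)"
    proof (rule sum.cong[OF refl])
      fix l assume "l \<in> {..<n}"
      then show "(\<Sum>k<n. if k \<le> l then e (l - k) k l else 0) = (\<Sum>k\<le>l. e (l - k) k l)"
        by (intro sum.mono_neutral_cong_right) auto
    qed
    also have "\<dots> = (\<Sum>l<n. (\<Sum>k<l. e (l - k) k l) + complex_of_real ((norm (s l))\<^sup>2))"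
      by (intro sum.cong refl)
        (simp add: e_def one cinner_self lessThan_Suc_atMost[symmetric] del: of_real_power)
    finally show ?thesis
      unfolding a_def P0 toeplitz_form_def e_def
      by (simp add: sum.distrib sum_distrib_left del: of_real_power)
  qed
  have partial: "0 \<le> (\<Sum>L<N. a L)" for N
  proof -
    \<comment> \<open>so large that \<open>m + k\<close> and \<open>l\<close> are equal if they are congruent modulo \<open>M\<close>\<close>
    define M where "M = N + n + 1"
    define z where "z j = cis (2 * pi * real j / real M)" for j
    define \<xi> where "\<xi> j = (\<Sum>k<n. z j ^ k *\<^sub>C s k)" for j
    define I where "I j m = cinner (blinfun_apply (F (z j ^ m *\<^sub>C f ^ m)) (\<xi> j)) (\<xi> j)" for j m
    have I: "I j m = (\<Sum>l<n. \<Sum>k<n. (z j ^ (m + k) * cnj (z j ^ l)) * e m k l)" for j m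
      unfolding I_def \<xi>_def e_def
      by (simp add: scale apply_scaleC power_mem f cinner_scaleC_left cinner_scaleC_right cinner_sum_left
          cinner_sum_right blinfun.sum_right sum_distrib_left power_add mult_ac)
    have avg: "(\<Sum>j<M. I j m) = of_nat M * P m" if "m \<le> N" for m
    proof -
      have "(\<Sum>j<M. I j m) =
          (\<Sum>l<n. \<Sum>k<n. (\<Sum>j<M. z j ^ (m + k) * cnj (z j ^ l)) * e m k l)"
        unfolding I
        by (subst sum.swap, rule sum.cong[OF refl], subst sum.swap) (simp only: sum_distrib_right)
      also have "\<dots> = (\<Sum>l<n. \<Sum>k<n. (if m + k = l then of_nat M else 0) * e m k l)"
        unfolding z_def using that
        by (intro sum.cong refl arg_cong2[where f = "(*)"] sum_powers_root_of_unity)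
          (auto simp: M_def)
      also have "\<dots> = of_nat M * P m"
        unfolding P_def sum_distrib_left by (intro sum.cong refl) simp
      finally show ?thesis .
    qed
    have pos: "0 \<le> (\<Sum>L<N. 2 * Re (\<Sum>m\<le>L. I j m) - Re (I j 0))" for j
    proof -
      define h where "h =
        (\<Sum>L<N. complex_of_real 2 *\<^sub>C (\<Sum>m\<le>L. z j ^ m *\<^sub>C f ^ m) + complex_of_real (- 1) *\<^sub>C 1)"
      have mem: "z j ^ m *\<^sub>C f ^ m \<in> A" for m by (intro scale_mem power_mem f)
      have h: "h \<in> A"
        unfolding h_def by (intro sum_mem add_mem scale_mem one_mem mem)
      have apply_sum: "apply_bcontfun (\<Sum>i\<in>S. g i) x = (\<Sum>i\<in>S. apply_bcontfun (g i) x)"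
        for S :: "nat set" and g :: "nat \<Rightarrow> 'x \<Rightarrow>\<^sub>C complex" and x
        by (induction S rule: infinite_finite_induct) simp_all
      have apply_power: "apply_bcontfun (f ^ m) x = apply_bcontfun f x ^ m" for m x
        by (induction m) simp_all
      have "0 \<le> Re (apply_bcontfun h x)" for x
      proof -
        define y where "y = z j * apply_bcontfun f x"
        have "cmod y \<le> 1"
          using norm_bounded[of f x] norm_f by (simp add: y_def z_def norm_mult)
        have "apply_bcontfun h x = (\<Sum>L<N. 2 * (\<Sum>m\<le>L. y ^ m) - 1)"
          unfolding h_def y_def
          by (simp add: apply_sum apply_power scaleC_complex_def power_mult_distrib)
        then show ?thesis
          using Re_fejer_sum_nonneg[OF \<open>cmod y \<le> 1\<close>, of N] by simp
      qed
      then have "0 \<le> Re (cinner (blinfun_apply (F h) (\<xi> j)) (\<xi> j))"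
        by (rule accretive[OF h])
      also have "cinner (blinfun_apply (F h) (\<xi> j)) (\<xi> j) =
          (\<Sum>L<N. 2 * (\<Sum>m\<le>L. I j m) - I j 0)"
        unfolding h_def I_def
        by (simp add: sum add scale mem sum_mem scale_mem one_mem add_mem blinfun.sum_left
            blinfun.add_left cinner_sum_left cinner_add_left cinner_scaleC_left one cinner_minus_left)
      finally show ?thesis by simp
    qed
    have "0 \<le> (\<Sum>j<M. \<Sum>L<N. 2 * Re (\<Sum>m\<le>L. I j m) - Re (I j 0))"
      by (intro sum_nonneg pos)
    also have "\<dots> = (\<Sum>L<N. \<Sum>j<M. 2 * Re (\<Sum>m\<le>L. I j m) - Re (I j 0))"
      by (rule sum.swap)
    also have "\<dots> = (\<Sum>L<N. 2 * Re (\<Sum>m\<le>L. \<Sum>j<M. I j m) - Re (\<Sum>j<M. I j 0))"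
      by (subst sum.swap[of "\<lambda>m j. I j m"])
         (simp add: sum_subtractf sum_distrib_left)
    also have "\<dots> = (\<Sum>L<N. real M * a L)"
    proof (intro sum.cong refl)
      fix L assume "L \<in> {..<N}"
      then have "(\<Sum>m\<le>L. \<Sum>j<M. I j m) = of_nat M * (\<Sum>m\<le>L. P m)"
        unfolding sum_distrib_left by (intro sum.cong refl avg) simp
      then show "2 * Re (\<Sum>m\<le>L. \<Sum>j<M. I j m) - Re (\<Sum>j<M. I j 0) = real M * a L"
        unfolding a_def avg[OF le0] by (simp add: algebra_simps del: Re_sum)
    qed
    finally have "0 \<le> real M * (\<Sum>L<N. a L)" by (simp only: sum_distrib_left)
    then show ?thesis by (simp add: M_def zero_le_mult_iff)
  qed
  show ?thesis by (rule nonneg_if_partial_sums_nonneg[OF partial const])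
qed

end

section \<open>The norm estimate\<close>

lemma square_sum_le_weighted:
  fixes p :: "nat \<Rightarrow> real"
  shows "(\<Sum>k<n. p k)\<^sup>2 \<le> (\<Sum>k<n. 2 ^ Suc k * (p k)\<^sup>2)"
proof (induction n arbitrary: p)
  case (Suc n)
  define S where "S = (\<Sum>k<n. p (Suc k))"
  have "S\<^sup>2 \<le> (\<Sum>k<n. 2 ^ Suc k * (p (Suc k))\<^sup>2)"
    unfolding S_def by (rule Suc.IH)
  then have "2 * S\<^sup>2 \<le> 2 * (\<Sum>k<n. 2 ^ Suc k * (p (Suc k))\<^sup>2)" by simp
  also have "\<dots> = (\<Sum>k<n. 2 ^ Suc (Suc k) * (p (Suc k))\<^sup>2)"
    by (simp add: sum_distrib_left mult.assoc)
  finally have "2 * S\<^sup>2 \<le> (\<Sum>k<n. 2 ^ Suc (Suc k) * (p (Suc k))\<^sup>2)" .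
  moreover have "(p 0 + S)\<^sup>2 \<le> 2 * (p 0)\<^sup>2 + 2 * S\<^sup>2"
    using zero_le_power2[of "p 0 - S"] unfolding power2_sum power2_diff by linarith
  ultimately show ?case
    unfolding sum.lessThan_Suc_shift S_def by simp
qed simp

lemma toeplitz_form_le:
  assumes "\<And>m. norm (E m) \<le> 1"
  shows "toeplitz_form E s n \<le> (\<Sum>k<n. norm (s k))\<^sup>2"
proof (induction n)
  case (Suc n)
  have "Re (cinner (blinfun_apply (E m) u) v) \<le> norm u * norm v" for m u v
  proof -
    have "norm (blinfun_apply (E m) u) \<le> 1 * norm u"
      by (rule order_trans[OF norm_blinfun]) (intro mult_right_mono assms norm_ge_zero)
    then have "norm (blinfun_apply (E m) u) * norm v \<le> norm u * norm v"
      by (intro mult_right_mono) simp_all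
    with Re_cinner_le show ?thesis by (rule order_trans)
  qed
  then have "(\<Sum>k<n. Re (cinner (blinfun_apply (E (n - k)) (s k)) (s n)))
      \<le> (\<Sum>k<n. norm (s k)) * norm (s n)"
    unfolding sum_distrib_right by (intro sum_mono)
  with Suc show ?case
    unfolding toeplitz_form_def by (simp add: power2_sum)
qed (simp add: toeplitz_form_def)

text \<open>The rows of \<open>s 0\<close> and \<open>s 1\<close> are split off, since their unknown terms are to be compared.\<close>

lemma toeplitz_form_Suc_Suc:
  "toeplitz_form E s (Suc (Suc n)) =
     (norm (s 0))\<^sup>2 + (norm (s 1))\<^sup>2 + 2 * Re (cinner (blinfun_apply (E 1) (s 0)) (s 1))
     + (\<Sum>j<n. 2 * Re (cinner (blinfun_apply (E (j + 2)) (s 0)) (s (j + 2)))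
          + 2 * Re (cinner (blinfun_apply (E (j + 1)) (s 1)) (s (j + 2))))
     + toeplitz_form E (\<lambda>k. s (k + 2)) n"
  unfolding toeplitz_form_def sum.lessThan_Suc_shift
  by (simp add: sum.distrib algebra_simps)

lemma nearly_norming_vector:
  fixes T :: "'h::real_normed_vector \<Rightarrow>\<^sub>L 'h"
  assumes "0 < norm T" and "0 < \<epsilon>"
  obtains x where "norm x = 1" and "(norm T)\<^sup>2 - \<epsilon> \<le> (norm (blinfun_apply T x))\<^sup>2"
proof -
  define c where "c = sqrt (max 0 ((norm T)\<^sup>2 - \<epsilon>))"
  have c0: "0 \<le> c" and c2: "c\<^sup>2 = max 0 ((norm T)\<^sup>2 - \<epsilon>)" by (simp_all add: c_def)
  have "c < norm T"
    by (rule power2_less_imp_less) (use assms c2 in auto)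
  then have "\<not> (\<forall>x. norm (blinfun_apply T x) \<le> c * norm x)"
    using norm_blinfun_bound[OF c0, of T] by (auto simp: mult.commute)
  then obtain u where u: "c * norm u < norm (blinfun_apply T u)" by (auto simp: not_le)
  then have u0: "norm u > 0" by auto
  define x where "x = (1 / norm u) *\<^sub>R u"
  have "c \<le> norm (blinfun_apply T x)"
    using u u0 by (simp add: x_def blinfun.scaleR_right field_simps)
  then have "c\<^sup>2 \<le> (norm (blinfun_apply T x))\<^sup>2"
    using c0 by (intro power_mono)
  moreover have "norm x = 1" using u0 by (simp add: x_def)
  ultimately show ?thesis using that c2 by force
qed

text \<open>
  The estimate with all errors explicit, for a truncation length \<open>n\<close> and a unit vector \<open>x\<close> that is
  norming for \<open>T\<close> up to \<open>t\<^sup>2\<close>.  The operator \<open>G m\<close> is the adjoint of \<open>2 E m - T ^ m\<close> with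
  respect to the real inner product \<open>Re (cinner u v)\<close>.
\<close>

lemma norm_le_two_aux:
  fixes T :: "'h::complex_hilbert_space \<Rightarrow>\<^sub>L 'h"
    and E G :: "nat \<Rightarrow> 'h \<Rightarrow>\<^sub>L 'h"
  assumes toeplitz: "\<And>s n. 0 \<le> toeplitz_form E s n"
    and contr: "\<And>m. norm (E m) \<le> 1"
    and E: "\<And>m u v. 2 * Re (cinner (blinfun_apply (E m) u) v) =
       Re (cinner ((blinfun_apply T ^^ m) u) v) + Re (cinner u (blinfun_apply (G m) v))"
    and comm: "\<And>m u. blinfun_apply (G m) (blinfun_apply T u) = blinfun_apply T (blinfun_apply (G m) u)"
    and bound: "\<And>m u. norm (blinfun_apply (G m) ((blinfun_apply T ^^ m) u)) \<le> C * norm u"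
    and C: "0 \<le> C" and K: "2 \<le> norm T"
    and t: "0 < t" and x: "norm x = 1" "(norm T)\<^sup>2 - t\<^sup>2 \<le> (norm (blinfun_apply T x))\<^sup>2"
  shows "norm T \<le> 2 + t\<^sup>2 * norm T + C * (1 / 2) ^ n + t * (1 + (norm T)\<^sup>2 * C\<^sup>2)"
proof -
  define K where "K = norm T"
  define a where "a = 1 / K"
  have K2: "2 \<le> K" using K by (simp add: K_def)
  have a: "0 < a" "a \<le> 1 / 2" "a * K = 1" using K2 by (auto simp: a_def field_simps)
  define u where "u k = a ^ k *\<^sub>R (blinfun_apply T ^^ k) x" for k
  define w where "w m = blinfun_apply (G m) ((blinfun_apply T ^^ m) x)" for m
  define b where "b m = a ^ m * Re (cinner x (w m))" for m
  \<comment> \<open>\<open>q v v'\<close> is the real part of \<open>\<langle>(K\<^sup>2 - T\<^sup>* T) v, v'\<rangle>\<close>, a positive form that is small at \<open>x\<close>\<close>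
  define q where "q v v' = K\<^sup>2 * Re (cinner v v') -
     Re (cinner (blinfun_apply T v) (blinfun_apply T v'))" for v v'
  have w: "norm (w m) \<le> C" for m using bound[of m x] x by (simp add: w_def)
  have funpow_scaleR: "(blinfun_apply T ^^ m) (r *\<^sub>R v) = r *\<^sub>R (blinfun_apply T ^^ m) v" for m r v
    by (induction m) (simp_all add: blinfun.scaleR_right)
  have Tu: "(blinfun_apply T ^^ m) (u k) = K ^ m *\<^sub>R u (m + k)" for m k
  proof -
    have "K ^ m * a ^ (m + k) = (a * K) ^ m * a ^ k"
      by (simp add: power_add power_mult_distrib)
    then have "K ^ m * a ^ (m + k) = a ^ k" using a by simp
    then show ?thesis by (simp add: u_def funpow_scaleR funpow_add)
  qed
  have Tx: "(blinfun_apply T ^^ m) x = K ^ m *\<^sub>R u m" for m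
    using Tu[of m 0] by (simp add: u_def)
  have E0: "2 * Re (cinner (blinfun_apply (E m) x) (u m)) = K ^ m * (norm (u m))\<^sup>2 + b m" for m
  proof -
    have "Re (cinner x (blinfun_apply (G m) (u m))) = b m"
      by (simp add: u_def b_def w_def blinfun.scaleR_right cinner_scaleR_right)
    then show ?thesis
      unfolding E Tx by (simp add: cinner_scaleR_left cinner_self del: of_real_power)
  qed
  \<comment> \<open>the same unknown term \<open>b m\<close> as in \<open>E0\<close>, up to an error governed by \<open>q\<close>\<close>
  have E1: "2 * Re (cinner (blinfun_apply (E m) (u 1)) (u (Suc m))) =
      K ^ m * (norm (u (Suc m)))\<^sup>2 + b m - a ^ (m + 2) * q x (w m)" for m
  proof -
    have "Re (cinner (u 1) (blinfun_apply (G m) (u (Suc m)))) =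
        a ^ (m + 2) * Re (cinner (blinfun_apply T x) (blinfun_apply T (w m)))"
      by (simp add: u_def blinfun.scaleR_right cinner_scaleR_left cinner_scaleR_right comm w_def)
    also have "\<dots> = a ^ (m + 2) * K\<^sup>2 * Re (cinner x (w m)) - a ^ (m + 2) * q x (w m)"
      by (simp add: q_def algebra_simps)
    also have "a ^ (m + 2) * K\<^sup>2 = a ^ m"
    proof -
      have "a ^ (m + 2) * K\<^sup>2 = a ^ m * (a * K)\<^sup>2"
        by (simp only: power_add power_mult_distrib mult.assoc)
      then show ?thesis using a by simp
    qed
    finally show ?thesis
      unfolding E by (simp add: Tu cinner_scaleR_left cinner_self b_def del: of_real_power)
  qed
  have q_nonneg: "0 \<le> q v v" for v
  proof -
    have "(norm (blinfun_apply T v))\<^sup>2 \<le> (K * norm v)\<^sup>2"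
      unfolding K_def by (intro power_mono norm_blinfun) simp
    then show ?thesis
      by (simp add: q_def cinner_self power_mult_distrib del: of_real_power)
  qed
  have qx: "q x x \<le> t\<^sup>2"
    using x by (simp add: q_def cinner_self K_def del: of_real_power)
  have qw: "q v v \<le> K\<^sup>2 * (norm v)\<^sup>2" for v
    by (simp add: q_def cinner_self del: of_real_power)
  \<comment> \<open>Cauchy-Schwarz for \<open>q\<close> in the form of its positivity at \<open>x + t v\<close>\<close>
  have cross: "- (2 * q x v) \<le> t * (1 + K\<^sup>2 * C\<^sup>2)" if "norm v \<le> C" for v
  proof -
    have "0 \<le> q (x + t *\<^sub>R v) (x + t *\<^sub>R v)" by (rule q_nonneg)
    also have "\<dots> = q x x + 2 * t * q x v + t\<^sup>2 * q v v"
      unfolding q_def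
      using Re_cinner_commute[of v x] Re_cinner_commute[of "blinfun_apply T v" "blinfun_apply T x"]
      by (simp add: cinner_add_left cinner_add_right blinfun.add_right blinfun.scaleR_right
          cinner_scaleR_left cinner_scaleR_right algebra_simps power2_eq_square)
    also have "\<dots> \<le> t\<^sup>2 + 2 * t * q x v + t\<^sup>2 * (K\<^sup>2 * C\<^sup>2)"
    proof -
      have "K\<^sup>2 * (norm v)\<^sup>2 \<le> K\<^sup>2 * C\<^sup>2"
        using that by (intro mult_left_mono power_mono) simp_all
      then have "t\<^sup>2 * q v v \<le> t\<^sup>2 * (K\<^sup>2 * C\<^sup>2)"
        using qw[of v] by (intro mult_left_mono) (linarith, simp)
      with qx show ?thesis by linarith
    qed
    finally have "t * (- (2 * q x v)) \<le> t * (t * (1 + K\<^sup>2 * C\<^sup>2))"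
      by (simp add: algebra_simps power2_eq_square)
    with t show ?thesis by (simp only: mult_le_cancel_left_pos)
  qed
  \<comment> \<open>the test vectors for the Toeplitz form\<close>
  define s where "s k = (if k = 0 then x else - u k)" for k
  have "0 \<le> toeplitz_form E s (Suc (Suc n))" by (rule toeplitz)
  also have "\<dots> = 1 + (1 - K) * (norm (u 1))\<^sup>2 - b 1
      + (\<Sum>j<n. (b (Suc j) - b (Suc (Suc j))) + (K ^ Suc j - K ^ (j + 2)) * (norm (u (j + 2)))\<^sup>2
            - a ^ (j + 3) * q x (w (Suc j)))
      + toeplitz_form E (\<lambda>k. s (k + 2)) n"
  proof -
    have first: "2 * Re (cinner (blinfun_apply (E m) (s 0)) (s m)) =
        - (K ^ m * (norm (u m))\<^sup>2 + b m)" if "m > 0" for m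
      using that E0[of m] by (simp add: s_def cinner_minus_right)
    have second: "2 * Re (cinner (blinfun_apply (E (Suc j)) (s 1)) (s (Suc (Suc j)))) =
        K ^ Suc j * (norm (u (j + 2)))\<^sup>2 + b (Suc j) - a ^ (j + 3) * q x (w (Suc j))" for j
      using E1[of "Suc j"]
      by (simp add: s_def cinner_minus_right cinner_minus_left blinfun.minus_right numeral_3_eq_3)
    have "(\<Sum>j<n. 2 * Re (cinner (blinfun_apply (E (j + 2)) (s 0)) (s (j + 2)))
          + 2 * Re (cinner (blinfun_apply (E (j + 1)) (s 1)) (s (j + 2)))) =
        (\<Sum>j<n. (b (Suc j) - b (Suc (Suc j))) + (K ^ Suc j - K ^ (j + 2)) * (norm (u (j + 2)))\<^sup>2
            - a ^ (j + 3) * q x (w (Suc j)))"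
    proof (rule sum.cong[OF refl])
      fix j
      show "2 * Re (cinner (blinfun_apply (E (j + 2)) (s 0)) (s (j + 2)))
          + 2 * Re (cinner (blinfun_apply (E (j + 1)) (s 1)) (s (j + 2))) =
        (b (Suc j) - b (Suc (Suc j))) + (K ^ Suc j - K ^ (j + 2)) * (norm (u (j + 2)))\<^sup>2
            - a ^ (j + 3) * q x (w (Suc j))"
        using first[of "j + 2"] second[of j] by (simp add: algebra_simps)
    qed
    moreover have "(norm (s 0))\<^sup>2 = 1" "(norm (s 1))\<^sup>2 = (norm (u 1))\<^sup>2"
      using x by (simp_all add: s_def)
    ultimately show ?thesis
      unfolding toeplitz_form_Suc_Suc using first[of 1] by (simp add: algebra_simps)
  qed
  also have "\<dots> \<le> 1 + (1 - K) * (norm (u 1))\<^sup>2 - b (Suc n) + (\<Sum>j<n. - (a ^ (j + 3) * q x (w (Suc j))))"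
  proof -
    have "toeplitz_form E (\<lambda>k. s (k + 2)) n \<le> (\<Sum>k<n. norm (u (k + 2)))\<^sup>2"
      using toeplitz_form_le[OF contr, where s = "\<lambda>k. s (k + 2)" and n = n] by (simp add: s_def)
    also have "\<dots> \<le> (\<Sum>k<n. 2 ^ Suc k * (norm (u (k + 2)))\<^sup>2)"
      by (rule square_sum_le_weighted)
    also have "\<dots> \<le> (\<Sum>k<n. (K ^ (k + 2) - K ^ Suc k) * (norm (u (k + 2)))\<^sup>2)"
    proof (intro sum_mono mult_right_mono)
      fix k
      have "2 ^ Suc k * 1 \<le> K ^ Suc k * (K - 1)"
        using K2 by (intro mult_mono power_mono) simp_all
      then show "2 ^ Suc k \<le> K ^ (k + 2) - K ^ Suc k" by (simp add: algebra_simps)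
    qed simp
    finally have rest: "toeplitz_form E (\<lambda>k. s (k + 2)) n
        + (\<Sum>j<n. (K ^ Suc j - K ^ (j + 2)) * (norm (u (j + 2)))\<^sup>2) \<le> 0"
      by (simp add: left_diff_distrib sum_subtractf)
    \<comment> \<open>the unknown terms telescope\<close>
    have "(\<Sum>j<n. b (Suc j) - b (Suc (Suc j))) = b 1 - b (Suc n)"
      by (induction n) simp_all
    with rest show ?thesis
      by (simp add: sum.distrib sum_subtractf sum_negf)
  qed
  also have "(\<Sum>j<n. - (a ^ (j + 3) * q x (w (Suc j)))) \<le> t * (1 + K\<^sup>2 * C\<^sup>2) / 2"
  proof -
    have "(\<Sum>j<n. - (a ^ (j + 3) * q x (w (Suc j)))) \<le>
        (\<Sum>j<n. (1 / 2) ^ Suc j * (t * (1 + K\<^sup>2 * C\<^sup>2) / 2))"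
    proof (rule sum_mono)
      fix j
      have "a ^ (j + 3) \<le> (1 / 2) ^ (j + 3)" using a by (intro power_mono) simp_all
      also have "\<dots> \<le> (1 / 2) ^ Suc j" by (intro power_decreasing) simp_all
      finally have "a ^ (j + 3) * (t * (1 + K\<^sup>2 * C\<^sup>2) / 2) \<le>
          (1 / 2) ^ Suc j * (t * (1 + K\<^sup>2 * C\<^sup>2) / 2)"
        using t by (intro mult_right_mono) simp_all
      moreover have "a ^ (j + 3) * (- q x (w (Suc j))) \<le> a ^ (j + 3) * (t * (1 + K\<^sup>2 * C\<^sup>2) / 2)"
        using cross[OF w, of "Suc j"] a by (intro mult_left_mono) simp_all
      ultimately show "- (a ^ (j + 3) * q x (w (Suc j))) \<le>
          (1 / 2) ^ Suc j * (t * (1 + K\<^sup>2 * C\<^sup>2) / 2)"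
        unfolding mult_minus_right[symmetric] by (rule order_trans[rotated])
    qed
    also have "\<dots> = (\<Sum>j<n. (1 / 2) ^ Suc j) * (t * (1 + K\<^sup>2 * C\<^sup>2) / 2)"
      by (simp only: sum_distrib_right)
    also have "(\<Sum>j<n. (1 / 2 :: real) ^ Suc j) = 1 - (1 / 2) ^ n"
      by (induction n) simp_all
    also have "(1 - (1 / 2) ^ n) * (t * (1 + K\<^sup>2 * C\<^sup>2) / 2) \<le> 1 * (t * (1 + K\<^sup>2 * C\<^sup>2) / 2)"
      using t by (intro mult_right_mono) simp_all
    finally show ?thesis by simp
  qed
  finally have main: "0 \<le> 1 + (1 - K) * (norm (u 1))\<^sup>2 - b (Suc n) + t * (1 + K\<^sup>2 * C\<^sup>2) / 2"
    by simp
  have "- b (Suc n) \<le> C * (1 / 2) ^ n"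
  proof -
    have "\<bar>Re (cinner x (w (Suc n)))\<bar> \<le> C"
      using abs_Re_cinner_le[of x "w (Suc n)"] w[of "Suc n"] x by simp
    moreover have "a ^ Suc n \<le> (1 / 2) ^ n"
    proof -
      have "a ^ Suc n \<le> (1 / 2) ^ Suc n" using a by (intro power_mono) simp_all
      also have "\<dots> \<le> (1 / 2) ^ n" by (intro power_decreasing) simp_all
      finally show ?thesis .
    qed
    ultimately have "\<bar>a ^ Suc n\<bar> * \<bar>Re (cinner x (w (Suc n)))\<bar> \<le> (1 / 2) ^ n * C"
      using a by (intro mult_mono) simp_all
    then show ?thesis
      unfolding b_def abs_mult[symmetric] by (simp add: mult.commute)
  qed
  moreover have "(1 - K) * (norm (u 1))\<^sup>2 \<le> 1 - K + t\<^sup>2 * K"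
  proof -
    have "1 - t\<^sup>2 \<le> 1 - a\<^sup>2 * t\<^sup>2"
      using a power_le_one[of a 2] by (simp add: mult_left_le_one_le)
    also have "\<dots> = a\<^sup>2 * (K\<^sup>2 - t\<^sup>2)"
    proof -
      have "a\<^sup>2 * K\<^sup>2 = (a * K)\<^sup>2" by (simp only: power_mult_distrib)
      then show ?thesis using a by (simp add: right_diff_distrib)
    qed
    also have "\<dots> \<le> a\<^sup>2 * (norm (blinfun_apply T x))\<^sup>2"
      using x by (intro mult_left_mono) (simp_all add: K_def)
    also have "\<dots> = (norm (u 1))\<^sup>2"
      using a by (simp add: u_def power_mult_distrib)
    finally have "1 - t\<^sup>2 \<le> (norm (u 1))\<^sup>2" .
    then have "(K - 1) * (1 - t\<^sup>2) \<le> (K - 1) * (norm (u 1))\<^sup>2"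
      using K2 by (intro mult_left_mono) simp_all
    moreover have "(K - 1) * (1 - t\<^sup>2) = K - 1 - t\<^sup>2 * K + t\<^sup>2"
      "(1 - K) * (norm (u 1))\<^sup>2 = - ((K - 1) * (norm (u 1))\<^sup>2)"
      by (simp_all add: algebra_simps)
    ultimately show ?thesis using zero_le_power2[of t] by linarith
  qed
  moreover have "t * (1 + K\<^sup>2 * C\<^sup>2) / 2 \<le> t * (1 + K\<^sup>2 * C\<^sup>2)"
    using t by simp
  ultimately have "K \<le> 2 + t\<^sup>2 * K + C * (1 / 2) ^ n + t * (1 + K\<^sup>2 * C\<^sup>2)"
    using main by linarith
  then show ?thesis by (simp only: K_def)
qed

lemma norm_le_two:
  fixes T :: "'h::complex_hilbert_space \<Rightarrow>\<^sub>L 'h"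
    and E G :: "nat \<Rightarrow> 'h \<Rightarrow>\<^sub>L 'h"
  assumes toeplitz: "\<And>s n. 0 \<le> toeplitz_form E s n"
    and contr: "\<And>m. norm (E m) \<le> 1"
    and E: "\<And>m u v. 2 * Re (cinner (blinfun_apply (E m) u) v) =
       Re (cinner ((blinfun_apply T ^^ m) u) v) + Re (cinner u (blinfun_apply (G m) v))"
    and comm: "\<And>m u. blinfun_apply (G m) (blinfun_apply T u) = blinfun_apply T (blinfun_apply (G m) u)"
    and bound: "\<And>m u. norm (blinfun_apply (G m) ((blinfun_apply T ^^ m) u)) \<le> C * norm u"
    and C: "0 \<le> C"
  shows "norm T \<le> 2"
proof (rule ccontr)
  assume "\<not> norm T \<le> 2"
  then have K: "2 \<le> norm T" "0 < norm T" by linarith+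
  \<comment> \<open>one parameter drives both the truncation length and the defect of the norming vector\<close>
  define r where "r n = 1 / real (Suc n)" for n
  have r: "r \<longlonglongrightarrow> 0"
    unfolding r_def using LIMSEQ_inverse_real_of_nat by (simp add: inverse_eq_divide)
  have "norm T \<le> 2 + (r n)\<^sup>2 * norm T + C * (1 / 2) ^ n + r n * (1 + (norm T)\<^sup>2 * C\<^sup>2)" for n
  proof -
    have rn: "0 < r n" by (simp add: r_def)
    then obtain x where "norm x = 1" "(norm T)\<^sup>2 - (r n)\<^sup>2 \<le> (norm (blinfun_apply T x))\<^sup>2"
      using nearly_norming_vector[OF K(2), of "(r n)\<^sup>2"] by auto
    from norm_le_two_aux[OF toeplitz contr E comm bound C K(1) rn this] show ?thesis .
  qed
  moreover have "(\<lambda>n. 2 + (r n)\<^sup>2 * norm T + C * (1 / 2) ^ n + r n * (1 + (norm T)\<^sup>2 * C\<^sup>2))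
      \<longlonglongrightarrow> 2 + 0\<^sup>2 * norm T + C * 0 + 0 * (1 + (norm T)\<^sup>2 * C\<^sup>2)"
    by (intro tendsto_intros r LIMSEQ_power_zero) simp
  ultimately have "norm T \<le> 2 + 0\<^sup>2 * norm T + C * 0 + 0 * (1 + (norm T)\<^sup>2 * C\<^sup>2)"
    by (intro LIMSEQ_le_const) auto
  with \<open>\<not> norm T \<le> 2\<close> show False by simp
qed

theorem theorem2p1:
  fixes A :: "('x::t2_space \<Rightarrow>\<^sub>C complex) set"
    and \<theta> :: "('x \<Rightarrow>\<^sub>C complex) \<Rightarrow> ('h::complex_hilbert_space \<Rightarrow>\<^sub>L 'h)"
    and \<alpha> :: "('x \<Rightarrow>\<^sub>C complex) \<Rightarrow> ('x \<Rightarrow>\<^sub>C complex)"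
  assumes "compact (UNIV :: 'x set)"
    and "uniform_algebra A"
    and "unital_homomorphism_on A \<theta>" and "bounded_map_on A \<theta>"
    and "unital_antilinear_on A \<alpha>" and "bounded_map_on A \<alpha>"
    and "\<forall>h\<in>A. norm (Phi \<theta> \<alpha> h) \<le> norm h"
  shows "\<forall>h\<in>A. norm (\<theta> h) \<le> 2 * norm h"
proof -
  have \<theta>: "\<theta> f \<in> bounded_operators" "\<theta> (f + g) = \<theta> f + \<theta> g" "\<theta> (f * g) = \<theta> f o\<^sub>L \<theta> g"
      "blinfun_apply (\<theta> (c *\<^sub>C f)) x = c *\<^sub>C blinfun_apply (\<theta> f) x" "\<theta> 1 = id_blinfun"
    if "f \<in> A" "g \<in> A" for f g c x
    using assms(3) that by (auto simp: unital_homomorphism_on_def)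
  have \<alpha>: "\<alpha> f \<in> A" "\<alpha> (f + g) = \<alpha> f + \<alpha> g" "\<alpha> (c *\<^sub>C f) = cnj c *\<^sub>C \<alpha> f" "\<alpha> 1 = 1"
    if "f \<in> A" "g \<in> A" for f g c
    using assms(5) that by (auto simp: unital_antilinear_on_def)
  have Phi: "cinner (blinfun_apply (Phi \<theta> \<alpha> h) u) v =
      (cinner (blinfun_apply (\<theta> h) u) v + cinner u (blinfun_apply (\<theta> (\<alpha> h)) v)) / 2"
    if h: "h \<in> A" for h u v
  proof -
    have "cinner (blinfun_apply (cadjoint (\<theta> (\<alpha> h))) u) v = cinner u (blinfun_apply (\<theta> (\<alpha> h)) v)"
      using cadjoint[OF \<theta>(1)[OF \<alpha>(1)[OF h h] h], of v u] cinner_commute by metis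
    then show ?thesis
      by (simp add: Phi_def blinfun.scaleR_left blinfun.add_left cinner_scaleR_left cinner_add_left)
  qed
  have eqI: "y = z" if "\<And>v. cinner y v = cinner z v" for y z :: 'h
    by (rule cinner_eqI) (metis cinner_commute that)
  interpret unital_contraction A "Phi \<theta> \<alpha>"
  proof
    have 1: "1 \<in> A" using assms(2) by (simp add: uniform_algebra_def)
    show "uniform_algebra A" by fact
    show "Phi \<theta> \<alpha> h \<in> bounded_operators" if h: "h \<in> A" for h
    proof -
      have *: "blinfun_apply (\<theta> g) (c *\<^sub>C u) = c *\<^sub>C blinfun_apply (\<theta> g) u" if "g \<in> A" for g c u
        using \<theta>(1)[OF that that] by (simp add: bounded_operators_def)
      have "blinfun_apply (Phi \<theta> \<alpha> h) (c *\<^sub>C u) = c *\<^sub>C blinfun_apply (Phi \<theta> \<alpha> h) u" for c u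
        by (rule eqI) (simp add: Phi[OF h] *[OF h] cinner_scaleC_left algebra_simps)
      then show ?thesis by (simp add: bounded_operators_def)
    qed
    show "Phi \<theta> \<alpha> (g + h) = Phi \<theta> \<alpha> g + Phi \<theta> \<alpha> h" if "g \<in> A" "h \<in> A" for g h
    proof -
      have "g + h \<in> A" using that assms(2) by (simp add: uniform_algebra_def)
      with that show ?thesis
        by (intro blinfun_eqI eqI)
          (simp add: Phi \<theta> \<alpha> blinfun.add_left cinner_add_left cinner_add_right add_divide_distrib)
    qed
    show "blinfun_apply (Phi \<theta> \<alpha> (c *\<^sub>C h)) u = c *\<^sub>C blinfun_apply (Phi \<theta> \<alpha> h) u"
      if "h \<in> A" for c h u
    proof -
      have "c *\<^sub>C h \<in> A" using that assms(2) by (simp add: uniform_algebra_def)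
      with that show ?thesis
        by (intro eqI) (simp add: Phi \<theta>(4) \<alpha> cinner_scaleC_left cinner_scaleC_right algebra_simps)
    qed
    show "Phi \<theta> \<alpha> 1 = id_blinfun"
      by (intro blinfun_eqI eqI) (simp add: Phi 1 \<theta>(5)[OF 1 1] \<alpha>(4)[OF 1 1])
    show "norm (Phi \<theta> \<alpha> h) \<le> norm h" if "h \<in> A" for h
      using assms(7) that by blast
  qed
  obtain C0 D0 where C0: "\<And>h. h \<in> A \<Longrightarrow> norm (\<theta> h) \<le> C0 * norm h"
    and D0: "\<And>h. h \<in> A \<Longrightarrow> norm (\<alpha> h) \<le> D0 * norm h"
    using assms(4,6) unfolding bounded_map_on_def by blast
  define C D where "C = max 0 C0" and "D = max 0 D0"
  have C: "norm (\<theta> h) \<le> C * norm h" and D: "norm (\<alpha> h) \<le> D * norm h" if "h \<in> A" for h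
    using C0[OF that] D0[OF that] mult_right_mono[of C0 C "norm h"] mult_right_mono[of D0 D "norm h"]
    by (auto simp: C_def D_def)
  have CD: "0 \<le> C" "0 \<le> D" by (simp_all add: C_def D_def)
  have unit: "norm (\<theta> f) \<le> 2" if f: "f \<in> A" and norm_f: "norm f \<le> 1" for f
  proof (rule norm_le_two)
    have fm: "f ^ m \<in> A" for m by (rule power_mem[OF f])
    have norm_fm: "norm (f ^ m) \<le> 1" for m
      using norm_power_ineq[of f m] power_le_one[OF norm_ge_zero norm_f, of m] by linarith
    have power: "blinfun_apply (\<theta> (f ^ m)) = blinfun_apply (\<theta> f) ^^ m" for m
      by (induction m) (simp_all add: \<theta>(5)[OF f f] \<theta>(3)[OF f fm] fun_eq_iff)
    have \<alpha>fm: "\<alpha> (f ^ m) \<in> A" for m by (rule \<alpha>(1)[OF fm fm])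
    show "0 \<le> toeplitz_form (\<lambda>m. Phi \<theta> \<alpha> (f ^ m)) s n" for s n
      by (rule toeplitz_form_nonneg[OF f norm_f])
    show "norm (Phi \<theta> \<alpha> (f ^ m)) \<le> 1" for m
      using contractive[OF fm] norm_fm by (rule order_trans)
    show "2 * Re (cinner (blinfun_apply (Phi \<theta> \<alpha> (f ^ m)) u) v) =
        Re (cinner ((blinfun_apply (\<theta> f) ^^ m) u) v)
        + Re (cinner u (blinfun_apply (\<theta> (\<alpha> (f ^ m))) v))" for m u v
      by (simp add: Phi[OF fm] power)
    show "blinfun_apply (\<theta> (\<alpha> (f ^ m))) (blinfun_apply (\<theta> f) u) =
        blinfun_apply (\<theta> f) (blinfun_apply (\<theta> (\<alpha> (f ^ m))) u)" for m u
    proof -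
      have "\<alpha> (f ^ m) * f = f * \<alpha> (f ^ m)"
        by (rule bcontfun_eqI) (simp add: mult.commute)
      then have "\<theta> (\<alpha> (f ^ m)) o\<^sub>L \<theta> f = \<theta> f o\<^sub>L \<theta> (\<alpha> (f ^ m))"
        by (metis \<theta>(3) f \<alpha>fm)
      then show ?thesis by (metis blinfun_apply_blinfun_compose)
    qed
    show "norm (blinfun_apply (\<theta> (\<alpha> (f ^ m))) ((blinfun_apply (\<theta> f) ^^ m) u)) \<le> (C * D * C) * norm u"
      for m u
    proof -
      have 1: "norm (\<theta> (f ^ m)) \<le> C"
        using order_trans[OF C[OF fm] mult_left_mono[OF norm_fm CD(1)]] by simp
      have "norm (\<alpha> (f ^ m)) \<le> D"
        using order_trans[OF D[OF fm] mult_left_mono[OF norm_fm CD(2)]] by simp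
      then have 2: "norm (\<theta> (\<alpha> (f ^ m))) \<le> C * D"
        using order_trans[OF C[OF \<alpha>fm] mult_left_mono[OF _ CD(1)]] by simp
      have "norm (blinfun_apply (\<theta> (f ^ m)) u) \<le> C * norm u"
        by (rule order_trans[OF norm_blinfun]) (intro mult_right_mono 1 norm_ge_zero)
      moreover have "norm (blinfun_apply (\<theta> (\<alpha> (f ^ m))) (blinfun_apply (\<theta> (f ^ m)) u))
          \<le> norm (\<theta> (\<alpha> (f ^ m))) * norm (blinfun_apply (\<theta> (f ^ m)) u)"
        by (rule norm_blinfun)
      ultimately have "norm (blinfun_apply (\<theta> (\<alpha> (f ^ m))) (blinfun_apply (\<theta> (f ^ m)) u))
          \<le> (C * D) * (C * norm u)"
        using CD by (elim order_trans) (intro mult_mono 2, simp_all)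
      then show ?thesis by (simp add: power mult_ac)
    qed
    show "0 \<le> C * D * C" using CD by simp
  qed
  show ?thesis
  proof
    fix h assume h: "h \<in> A"
    show "norm (\<theta> h) \<le> 2 * norm h"
    proof (cases "norm h = 0")
      case True
      with C[OF h] show ?thesis by simp
    next
      case False
      define c where "c = complex_of_real (1 / norm h)"
      have c: "c *\<^sub>C h = (1 / norm h) *\<^sub>R h" unfolding c_def by (rule scaleC_of_real)
      have "\<theta> (c *\<^sub>C h) = (1 / norm h) *\<^sub>R \<theta> h"
      proof (rule blinfun_eqI)
        fix u
        have "blinfun_apply (\<theta> (c *\<^sub>C h)) u = c *\<^sub>C blinfun_apply (\<theta> h) u"
          by (rule \<theta>(4)[OF h h])
        also have "\<dots> = (1 / norm h) *\<^sub>R blinfun_apply (\<theta> h) u"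
          unfolding c_def by (rule scaleC_of_real)
        finally show "blinfun_apply (\<theta> (c *\<^sub>C h)) u = blinfun_apply ((1 / norm h) *\<^sub>R \<theta> h) u"
          by (simp add: blinfun.scaleR_left)
      qed
      moreover have "norm (\<theta> (c *\<^sub>C h)) \<le> 2"
        by (rule unit) (use False in \<open>simp_all add: scale_mem h, simp add: c\<close>)
      ultimately show ?thesis using False by (simp add: field_simps)
    qed
  qed
qed

end
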